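(* Let $M$ be a pure motive over $\mathbb{Q}$ of degree $d$ and weight $w$, with $L$-function $L(M,s)=\prod_p P_p(p^{-s})^{-1}=\sum_{n\ge1}c(n)n^{-s}$. Assume that for every prime $p$ of bad reduction the inverse roots of $P_p(T)$ have absolute value at most $p^{w/2}$, and that $p=3$ is a prime of good reduction. Let $\alpha\in\mathbb{C}$ with $0<|\alpha|<1$, and let $L(M,s,\psi)=\prod_p P_p(\alpha^p p^{-s})^{-1}=\sum_{n\ge1}\alpha^{S(n)}c(n)n^{-s}$ be the $\psi$-twisted $L$-function. Then the abscissa of convergence $\sigma_c$ and the abscissa of absolute convergence $\sigma_a$ of $L(M,s,\psi)$ satisfy $$\sigma_c=\sigma_a=\frac{3}{\log 3}\log|\alpha|+\frac{w}{2}.$$ Moreover, $L(M,s,\psi)$ extends to a meromorphic function on $\mathbb{C}$ that has no zeroes; its poles correspond to the zeroes of the local factors $P_p(\alpha^p p^{-s})$. Each prime $p$ of good reduction yields a family of poles whose real part is $\frac{p}{\log p}\log|\alpha|+\frac{w}{2}$ and whose imaginary parts are $\frac{2\pi}{\log p}$-periodic.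
   Context: For $n\in\mathbb{N}$, $S(n)$ denotes the sum of the prime factors of $n$ counted with multiplicity: $S(1)=0$ and $S(p_1^{k_1}\cdots p_r^{k_r})=k_1p_1+\dots+k_rp_r$. The twisting character is $\psi(n)=\alpha^{S(n)}$, a completely multiplicative function with $\psi(p)=\alpha^p$ for primes $p$. The $L$-function of $M$ is given as an Euler product over primes $p$ with local polynomials $P_p(T)\in\mathbb{C}[T]$, $P_p(0)=1$, of degree at most $d$. For primes $p$ of good reduction (all but finitely many), $P_p(T)=\det(1-\mathrm{Frob}_p T\mid V_\ell)$ is the characteristic polynomial of Frobenius on the relevant $\ell$-adic cohomology, of degree $d$, and factors as $\prod_{i=1}^d(1-c_{p,i}T)$ with $|c_{p,i}|=p^{w/2}$. The twisted $L$-function replaces each $P_p(T)$ by $P_p(\psi(p)T)=P_p(\alpha^pT)$; its (formal) Dirichlet series is $\sum_n \alpha^{S(n)}c(n)n^{-s}$, where $c(n)$ are the Dirichlet coefficients of $L(M,s)$. *)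

theory Defs
  imports "HOL-Complex_Analysis.Complex_Analysis"
begin

text \<open>
  The library has no motives.  A pure motive over the rationals enters through the data that define
  its \<open>L\<close>-function: degree \<open>d\<close>, weight \<open>w\<close>, finite set \<open>B\<close> of primes of bad reduction, and local
  polynomials \<open>P p\<close>.  At a good prime, \<open>c i\<close> are the eigenvalues of Frobenius, so that the product
  below is \<open>det (1 - Frob\<^sub>p T)\<close>; the condition on their absolute values is purity of weight \<open>w\<close>.
\<close>

locale pure_motive_L_data =
  fixes d :: nat and w :: int and B :: "nat set" and P :: "nat \<Rightarrow> complex poly"
  assumes finite_bad: "finite B"
    and bad_prime: "p \<in> B \<Longrightarrow> prime p"
    and local_poly_0: "prime p \<Longrightarrow> poly (P p) 0 = 1"
    and degree_local_poly: "prime p \<Longrightarrow> degree (P p) \<le> d"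
    and good_reduction: "prime p \<Longrightarrow> p \<notin> B \<Longrightarrow>
      \<exists>c :: nat \<Rightarrow> complex. P p = (\<Prod>i<d. [:1, - c i:]) \<and>
        (\<forall>i<d. cmod (c i) = real p powr (real_of_int w / 2))"

definition sum_prime_factors :: "nat \<Rightarrow> nat" where
  "sum_prime_factors n = (\<Sum>p\<in>prime_factors n. multiplicity p n * p)"

text \<open>
  The coefficients of the formal Dirichlet series obtained by expanding each factor
  \<open>1 / P p (p\<^sup>-\<^sup>s)\<close> of the Euler product as a power series in \<open>p\<^sup>-\<^sup>s\<close> and multiplying out.
\<close>

definition euler_coeff :: "(nat \<Rightarrow> complex poly) \<Rightarrow> nat \<Rightarrow> complex" where
  "euler_coeff P n =
     (\<Prod>p\<in>prime_factors n. fps_nth (inverse (fps_of_poly (P p))) (multiplicity p n))"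

definition twisted_coeff :: "(nat \<Rightarrow> complex poly) \<Rightarrow> complex \<Rightarrow> nat \<Rightarrow> complex" where
  "twisted_coeff P \<alpha> n = \<alpha> ^ sum_prime_factors n * euler_coeff P n"

definition twisted_local_factor ::
    "(nat \<Rightarrow> complex poly) \<Rightarrow> complex \<Rightarrow> nat \<Rightarrow> complex \<Rightarrow> complex" where
  "twisted_local_factor P \<alpha> p s = poly (P p) (\<alpha> ^ p * of_nat p powr (- s))"

text \<open>The index is shifted: position \<open>n\<close> holds the term of \<open>n + 1\<close>.\<close>

definition dirichlet_term :: "(nat \<Rightarrow> complex) \<Rightarrow> complex \<Rightarrow> nat \<Rightarrow> complex" where
  "dirichlet_term a s n = a (Suc n) * of_nat (Suc n) powr (- s)"

definition conv_abscissa :: "(nat \<Rightarrow> complex) \<Rightarrow> ereal" where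
  "conv_abscissa a = (INF s\<in>{s. summable (dirichlet_term a s)}. ereal (Re s))"

definition abs_conv_abscissa :: "(nat \<Rightarrow> complex) \<Rightarrow> ereal" where
  "abs_conv_abscissa a =
     (INF s\<in>{s. summable (\<lambda>n. norm (dirichlet_term a s n))}. ereal (Re s))"

end

theory Submission
  imports Defs "HOL-Computational_Algebra.Fundamental_Theorem_Algebra" "HOL-Real_Asymp.Real_Asymp"
begin

text \<open>
  At every prime, good or bad, \<open>P p\<close> is a product of \<open>d\<close> factors \<open>1 - c T\<close> with \<open>|c| \<le> p\<^sup>w\<^sup>/\<^sup>2\<close>, so the
  twisted local factor is controlled by \<open>x = |\<alpha>|\<^sup>p p\<^bsup>w/2 - Re s\<^esup>\<close>. These numbers are summable over \<open>p\<close>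
  for every \<open>s\<close>, hence the product of the \<open>P p (\<alpha>\<^sup>p p\<^sup>-\<^sup>s)\<close> is entire and vanishes exactly where one
  of its factors does; its reciprocal is the meromorphic continuation. As \<open>n\<^sup>3 \<le> 3\<^sup>n\<close>, the quotient
  \<open>p / log p\<close> is minimal at \<open>p = 3\<close>, so that \<open>x < 1\<close> for all \<open>p\<close> to the right of the claimed abscissa,
  where the local geometric series therefore multiply out to an absolutely convergent Dirichlet series.
  Further left the series diverges already along the powers of 3.
\<close>

section \<open>Local polynomials and the power series of their reciprocals\<close>

text \<open>This brings bad primes into the shape that good primes have by definition. A root
  \<open>z\<close> is split off as the factor \<open>1 - T/z\<close>; the normalisation
  \<open>poly Q 0 = 1\<close> ensures that \<open>z\<close> is not 0.\<close>

lemma poly_eq_prod_inverse_roots: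
  fixes Q :: "complex poly"
  assumes "poly Q 0 = 1" "degree Q \<le> d" "R \<ge> 0"
    and "\<And>z. poly Q z = 0 \<Longrightarrow> cmod (inverse z) \<le> R"
  shows "\<exists>c :: nat \<Rightarrow> complex. Q = (\<Prod>i<d. [:1, - c i:]) \<and> (\<forall>i<d. cmod (c i) \<le> R)"
  using assms
proof (induction d arbitrary: Q)
  case 0
  then obtain a where "Q = [:a:]"
    by (auto elim: degree_eq_zeroE)
  with 0 show ?case by (auto simp: one_pCons)
next
  case (Suc d)
  show ?case
  proof (cases "degree Q = 0")
    case True
    then obtain a where "Q = [:a:]"
      by (auto elim: degree_eq_zeroE)
    \<comment> \<open>Once the roots are exhausted, zero inverse roots pad the product to the
      prescribed number of factors.\<close>
    with Suc.prems show ?thesis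
      by (intro exI[of _ "\<lambda>_. 0"]) (auto simp flip: one_pCons)
  next
    case False
    then obtain z where z: "poly Q z = 0"
      using Fundamental_Theorem_Algebra.fundamental_theorem_of_algebra[of Q] by (auto simp: constant_degree)
    then have "z \<noteq> 0" using Suc.prems(1) by auto
    obtain Q1 where Q1: "Q = [:- z, 1:] * Q1"
      using z by (auto simp: poly_eq_0_iff_dvd)
    define Q2 where "Q2 = smult (- z) Q1"
    have Q: "Q = Q2 * [:1, - inverse z:]"
      using \<open>z \<noteq> 0\<close> by (simp add: Q1 Q2_def)
    have "Q2 \<noteq> 0" using False Q by auto
    have "\<exists>c :: nat \<Rightarrow> complex. Q2 = (\<Prod>i<d. [:1, - c i:]) \<and> (\<forall>i<d. cmod (c i) \<le> R)"
    proof (rule Suc.IH)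
      show "poly Q2 0 = 1" using Suc.prems(1) by (simp add: Q)
      have "degree Q = degree Q2 + 1"
        unfolding Q using \<open>Q2 \<noteq> 0\<close> \<open>z \<noteq> 0\<close> by (subst degree_mult_eq) auto
      then show "degree Q2 \<le> d" using Suc.prems(2) by simp
      show "cmod (inverse y) \<le> R" if "poly Q2 y = 0" for y
        using that Suc.prems(4) by (simp add: Q)
    qed fact
    then obtain c where c: "Q2 = (\<Prod>i<d. [:1, - c i:])" "\<forall>i<d. cmod (c i) \<le> R"
      by blast
    have "(\<Prod>i<d. [:1, - (c(d := inverse z)) i:]) = (\<Prod>i<d. [:1, - c i:])"
      by (intro prod.cong) auto
    then show ?thesis
      using c Suc.prems(4)[OF z]
      by (intro exI[of _ "c(d := inverse z)"]) (auto simp: Q less_Suc_eq)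
  qed
qed

text \<open>The reciprocal of each linear factor is a geometric series whose ratio has norm at most
  \<open>x\<close>, and Cauchy products multiply both the values and the bounds. The bound on the
  norms depends only on \<open>x\<close> and \<open>d\<close>, which later makes it summable over
  primes.\<close>

lemma inverse_fps_of_linear_prod_sums:
  fixes c :: "nat \<Rightarrow> complex" and z :: complex and x :: real
  assumes "\<And>i. i < d \<Longrightarrow> cmod (c i) * cmod z \<le> x" "0 \<le> x" "x < 1"
  defines "a \<equiv> \<lambda>d k. fps_nth (inverse (fps_of_poly (\<Prod>i<d. [:1, - c i:]))) k * z ^ k"
  shows "summable (\<lambda>k. norm (a d k)) \<and> (\<Sum>k. norm (a d k)) \<le> (1 / (1 - x)) ^ d \<and>
    a d sums inverse (poly (\<Prod>i<d. [:1, - c i:]) z)"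
  using assms(1)
proof (induction d)
  case 0
  have a0: "a 0 k = (if k = 0 then 1 else 0)" for k
    by (simp add: a_def)
  have "(\<lambda>k. if k = 0 then 1 else 0 :: real) sums 1" "(\<lambda>k. if k = 0 then 1 else 0 :: complex) sums 1"
    using sums_single[of 0 "\<lambda>_. 1"] by auto
  moreover have "norm (a 0 k) = (if k = 0 then 1 else 0)" for k
    by (simp add: a0)
  ultimately show ?case
    by (simp add: a0 sums_iff)
next
  case (Suc d)
  define b where "b = (\<lambda>k. (c d * z) ^ k)"
  have cz: "norm (c d * z) \<le> x"
    using Suc.prems[of d] by (simp add: norm_mult)
  have b1: "(\<lambda>k. norm (b k)) sums (1 / (1 - norm (c d * z)))"
    unfolding b_def norm_power using cz assms(3) by (intro geometric_sums) auto
  have b2: "b sums (1 / (1 - c d * z))"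
    unfolding b_def using cz assms(3) by (intro geometric_sums) auto
  have IH: "summable (\<lambda>k. norm (a d k))" "(\<Sum>k. norm (a d k)) \<le> (1 / (1 - x)) ^ d"
    "a d sums inverse (poly (\<Prod>i<d. [:1, - c i:]) z)"
    using Suc by auto
  have inv: "inverse (fps_of_poly [:1, - c d:]) = Abs_fps (\<lambda>k. c d ^ k)"
  proof (rule fps_inverse_unique)
    show "fps_of_poly [:1, - c d:] * Abs_fps (\<lambda>k. c d ^ k) = 1"
    proof (rule fps_ext)
      fix n show "fps_nth (fps_of_poly [:1, - c d:] * Abs_fps (\<lambda>k. c d ^ k)) n = fps_nth 1 n"
        by (cases n) (simp_all add: fps_of_poly_linear' algebra_simps)
    qed
  qed
  have conv: "a (Suc d) k = (\<Sum>i\<le>k. a d i * b (k - i))" for k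
  proof -
    have "a (Suc d) k = (\<Sum>i=0..k. fps_nth (inverse (fps_of_poly (\<Prod>i<d. [:1, - c i:]))) i
        * c d ^ (k - i)) * z ^ k"
      unfolding a_def prod.lessThan_Suc fps_of_poly_mult fps_inverse_mult fps_mult_nth inv by simp
    also have "\<dots> = (\<Sum>i\<le>k. a d i * b (k - i))"
      unfolding sum_distrib_right atMost_atLeast0
    proof (rule sum.cong)
      fix i assume "i \<in> {0..k}"
      then have "z ^ k = z ^ i * z ^ (k - i)" by (simp flip: power_add)
      then show "fps_nth (inverse (fps_of_poly (\<Prod>i<d. [:1, - c i:]))) i * c d ^ (k - i) * z ^ k
          = a d i * b (k - i)"
        by (simp add: a_def b_def power_mult_distrib mult_ac)
    qed simp
    finally show ?thesis .
  qed
  \<comment> \<open>The Cauchy product of the norms dominates the norms of the Cauchy product, so it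
    yields summability and the bound at once.\<close>
  have ns: "(\<lambda>k. \<Sum>i\<le>k. norm (a d i) * norm (b (k - i))) sums
      ((\<Sum>k. norm (a d k)) * (\<Sum>k. norm (b k)))"
    by (rule Cauchy_product_sums) (use IH b1 in \<open>auto simp: sums_iff\<close>)
  have le: "norm (a (Suc d) k) \<le> (\<Sum>i\<le>k. norm (a d i) * norm (b (k - i)))" for k
    unfolding conv by (rule sum_norm_le) (simp add: norm_mult)
  have summ: "summable (\<lambda>k. norm (a (Suc d) k))"
    by (rule summable_comparison_test'[OF sums_summable[OF ns], of 0]) (use le in auto)
  have "(\<Sum>k. norm (a (Suc d) k)) \<le> (\<Sum>k. norm (a d k)) * (\<Sum>k. norm (b k))"
    using suminf_le[OF le summ] ns by (auto simp: sums_iff)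
  also have "\<dots> \<le> (1 / (1 - x)) ^ d * (1 / (1 - x))"
  proof (intro mult_mono IH)
    show "(\<Sum>k. norm (b k)) \<le> 1 / (1 - x)"
      using b1 cz assms(3) by (simp add: sums_iff frac_le)
    show "0 \<le> (\<Sum>k. norm (b k))"
      by (rule suminf_nonneg[OF sums_summable[OF b1]]) simp
  qed (use assms in auto)
  finally have bound: "(\<Sum>k. norm (a (Suc d) k)) \<le> (1 / (1 - x)) ^ Suc d"
    by (simp add: mult_ac)
  have "(\<lambda>k. \<Sum>i\<le>k. a d i * b (k - i)) sums ((\<Sum>k. a d k) * (\<Sum>k. b k))"
    by (rule Cauchy_product_sums) (use IH b1 in \<open>auto simp: sums_iff\<close>)
  also have "(\<Sum>k. a d k) * (\<Sum>k. b k) = inverse (poly (\<Prod>i<Suc d. [:1, - c i:]) z)"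
    using IH(3) b2 by (auto simp: sums_iff field_simps)
  finally show ?case
    using summ bound by (auto simp: conv)
qed

subsection \<open>Euler products\<close>

text \<open>Smooth numbers over an arbitrary set of permitted primes. Positivity is explicit because
  \<open>prime_factors 0\<close> is empty.\<close>

definition smooth_numbers :: "nat set \<Rightarrow> nat set" where
  "smooth_numbers A = {n. n > 0 \<and> prime_factors n \<subseteq> A}"

lemma smooth_numbers_empty: "smooth_numbers {} = {1}"
  by (auto simp: smooth_numbers_def prime_factorization_empty_iff)

text \<open>Unique factorisation at a single prime, in the form that lets an Euler product grow by
  one prime at a time.\<close>

lemma bij_betw_smooth_numbers_insert:
  assumes "prime p" "p \<notin> A"
  shows "bij_betw (\<lambda>(n, k). n * p ^ k) (smooth_numbers A \<times> UNIV) (smooth_numbers (insert p A))"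
proof (rule bij_betw_byWitness[where f' = "\<lambda>m. (m div p ^ multiplicity p m, multiplicity p m)"])
  have mult: "multiplicity p (n * p ^ k) = k" if "n \<in> smooth_numbers A" for n k
  proof -
    have "\<not> p dvd n"
      using that assms by (auto simp: smooth_numbers_def in_prime_factors_iff)
    then show ?thesis
      using that assms by (simp add: smooth_numbers_def prime_elem_multiplicity_mult_distrib
        multiplicity_same_power not_dvd_imp_multiplicity_0)
  qed
  show "\<forall>a\<in>smooth_numbers A \<times> UNIV.
    (\<lambda>m. (m div p ^ multiplicity p m, multiplicity p m)) (case a of (n, k) \<Rightarrow> n * p ^ k) = a"
    using mult assms by (auto simp: prime_gt_0_nat)
  show "\<forall>m\<in>smooth_numbers (insert p A).
    (case (m div p ^ multiplicity p m, multiplicity p m) of (n, k) \<Rightarrow> n * p ^ k) = m"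
    by (simp add: multiplicity_dvd)
  show "(\<lambda>(n, k). n * p ^ k) ` (smooth_numbers A \<times> UNIV) \<subseteq> smooth_numbers (insert p A)"
  proof safe
    fix n k assume n: "n \<in> smooth_numbers A"
    have "q \<in> insert p A" if "prime q" "q dvd n * p ^ k" for q
    proof -
      have "q dvd n \<or> q dvd p"
        using that by (metis prime_dvd_mult_iff prime_dvd_power)
      then show ?thesis
        using n that assms primes_dvd_imp_eq[of q p]
        by (auto simp: smooth_numbers_def in_prime_factors_iff)
    qed
    then show "n * p ^ k \<in> smooth_numbers (insert p A)"
      using n assms by (auto simp: smooth_numbers_def in_prime_factors_iff prime_gt_0_nat)
  qed
  show "(\<lambda>m. (m div p ^ multiplicity p m, multiplicity p m)) ` smooth_numbers (insert p A)
    \<subseteq> smooth_numbers A \<times> UNIV"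
  proof safe
    fix m assume m: "m \<in> smooth_numbers (insert p A)"
    then have "m \<noteq> 0" by (simp add: smooth_numbers_def)
    define n where "n = m div p ^ multiplicity p m"
    have mn: "m = n * p ^ multiplicity p m"
      by (simp add: n_def multiplicity_dvd)
    have "\<not> p dvd n"
      unfolding n_def using \<open>m \<noteq> 0\<close> assms(1) by (metis multiplicity_decompose not_prime_unit)
    have "n > 0" using mn \<open>m \<noteq> 0\<close> by (cases n) auto
    moreover have "q \<in> A" if "q \<in> prime_factors n" for q
    proof -
      have "q \<in> prime_factors m"
        using that \<open>m \<noteq> 0\<close> mn by (metis dvd_triv_left in_prime_factors_iff dvd_trans)
      moreover have "q \<noteq> p" using that \<open>\<not> p dvd n\<close> by (auto simp: in_prime_factors_iff)
      ultimately show ?thesis using m by (auto simp: smooth_numbers_def)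
    qed
    ultimately show "m div p ^ multiplicity p m \<in> smooth_numbers A"
      by (auto simp: smooth_numbers_def n_def)
  qed simp
qed

text \<open>The multiplicative function whose value at a prime power \<open>p ^ k\<close> with
  \<open>k > 0\<close> is \<open>g p k\<close>.\<close>

definition prime_power_product :: "(nat \<Rightarrow> nat \<Rightarrow> 'a) \<Rightarrow> nat \<Rightarrow> 'a :: comm_monoid_mult" where
  "prime_power_product g n = (\<Prod>p\<in>prime_factors n. g p (multiplicity p n))"

text \<open>Since \<open>g p 0 = 1\<close>, the index set can be fixed independently of
  \<open>n\<close>.\<close>

lemma prime_power_product_superset:
  assumes "finite A" "\<And>p. p \<in> A \<Longrightarrow> prime p" "\<And>p. prime p \<Longrightarrow> g p 0 = 1" "n \<in> smooth_numbers A"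
  shows "prime_power_product g n = (\<Prod>p\<in>A. g p (multiplicity p n))"
  unfolding prime_power_product_def
  using assms by (intro prod.mono_neutral_left)
    (auto simp: smooth_numbers_def in_prime_factors_iff not_dvd_imp_multiplicity_0)

lemma prime_power_product_mult_power:
  assumes "finite A" "\<And>p. p \<in> A \<Longrightarrow> prime p" "\<And>p. prime p \<Longrightarrow> g p 0 = 1" "prime p" "p \<notin> A"
    and n: "n \<in> smooth_numbers A"
  shows "prime_power_product g (n * p ^ k) = prime_power_product g n * g p k"
proof -
  have "n > 0" "\<not> p dvd n"
    using n assms by (auto simp: smooth_numbers_def in_prime_factors_iff)
  have mult: "multiplicity q (n * p ^ k) = multiplicity q n + (if q = p then k else 0)"
    if "prime q" for q
    using that \<open>n > 0\<close> \<open>prime p\<close>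
    by (auto simp: prime_elem_multiplicity_mult_distrib multiplicity_same_power
      prime_multiplicity_other not_dvd_imp_multiplicity_0 prime_elem_multiplicity_power_distrib
      multiplicity_distinct_prime_power)
  have "n * p ^ k \<in> smooth_numbers (insert p A)"
    using bij_betw_imp_surj_on[OF bij_betw_smooth_numbers_insert[OF assms(4,5)]] n by force
  then have "prime_power_product g (n * p ^ k)
      = (\<Prod>q\<in>insert p A. g q (multiplicity q (n * p ^ k)))"
    using assms by (intro prime_power_product_superset) auto
  also have "\<dots> = g p k * (\<Prod>q\<in>A. g q (multiplicity q n))"
  proof -
    have "multiplicity p (n * p ^ k) = k"
      using assms \<open>\<not> p dvd n\<close> by (simp add: mult not_dvd_imp_multiplicity_0)
    moreover have "(\<Prod>q\<in>A. g q (multiplicity q (n * p ^ k))) = (\<Prod>q\<in>A. g q (multiplicity q n))"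
      by (rule prod.cong) (use assms mult in auto)
    ultimately show ?thesis
      using assms by simp
  qed
  also have "(\<Prod>q\<in>A. g q (multiplicity q n)) = prime_power_product g n"
    using assms by (intro prime_power_product_superset[symmetric]) auto
  finally show ?thesis by (simp add: mult.commute)
qed

text \<open>The finite Euler product. The bijection for \<open>insert p A\<close> turns the sum over
  smooth numbers into one over pairs \<open>(n, k)\<close>, where the summand separates; summing
  over \<open>k\<close> first splits off the factor of \<open>p\<close>. Absolute summability is
  carried through the induction because it justifies the iterated summation.\<close>

lemma has_sum_smooth_numbers:
  fixes g :: "nat \<Rightarrow> nat \<Rightarrow> 'a :: {real_normed_field, banach}"
  assumes "finite A" "\<And>p. p \<in> A \<Longrightarrow> prime p" "\<And>p. prime p \<Longrightarrow> g p 0 = 1"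
    and "\<And>p. p \<in> A \<Longrightarrow> summable (\<lambda>k. norm (g p k))"
  shows "(\<lambda>n. norm (prime_power_product g n)) summable_on smooth_numbers A \<and>
    (prime_power_product g has_sum (\<Prod>p\<in>A. \<Sum>k. g p k)) (smooth_numbers A)"
  using assms(1,2,4)
proof (induction A rule: finite_induct)
  case empty
  then show ?case
    by (auto simp: smooth_numbers_empty prime_power_product_def intro!: has_sum_finiteI)
next
  case (insert p A)
  have p: "prime p" using insert.prems by auto
  have IH: "(\<lambda>n. norm (prime_power_product g n)) summable_on smooth_numbers A"
    "(prime_power_product g has_sum (\<Prod>p\<in>A. \<Sum>k. g p k)) (smooth_numbers A)"
    using insert by auto
  have gp: "summable (\<lambda>k. norm (g p k))" using insert.prems by auto
  have gp1: "(g p has_sum (\<Sum>k. g p k)) UNIV"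
    using gp summable_norm_cancel[OF gp] by (intro norm_summable_imp_has_sum summable_sums)
  have gp2: "((\<lambda>k. norm (g p k)) has_sum (\<Sum>k. norm (g p k))) UNIV"
    using gp by (intro norm_summable_imp_has_sum summable_sums) auto
  have eq: "prime_power_product g (n * p ^ k) = prime_power_product g n * g p k"
    if "n \<in> smooth_numbers A" for n k
    using insert.hyps insert.prems assms(3) that
    by (intro prime_power_product_mult_power[of A]) auto
  let ?h = "\<lambda>(n, k). prime_power_product g n * g p k"
  have summ: "(\<lambda>x. norm (?h x)) summable_on smooth_numbers A \<times> UNIV"
  proof (rule summable_on_SigmaI)
    show "((\<lambda>k. norm (?h (n, k))) has_sum norm (prime_power_product g n) * (\<Sum>k. norm (g p k))) UNIV"
      for n
      using has_sum_cmult_right[OF gp2] by (simp add: norm_mult)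
    show "(\<lambda>n. norm (prime_power_product g n) * (\<Sum>k. norm (g p k))) summable_on smooth_numbers A"
      by (rule summable_on_cmult_left[OF IH(1)])
  qed simp
  have "(?h has_sum (\<Prod>p\<in>A. \<Sum>k. g p k) * (\<Sum>k. g p k)) (smooth_numbers A \<times> UNIV)"
  proof (rule has_sum_SigmaI)
    show "((\<lambda>k. ?h (n, k)) has_sum prime_power_product g n * (\<Sum>k. g p k)) UNIV" for n
      using has_sum_cmult_right[OF gp1] by simp
    show "((\<lambda>n. prime_power_product g n * (\<Sum>k. g p k)) has_sum
        (\<Prod>p\<in>A. \<Sum>k. g p k) * (\<Sum>k. g p k)) (smooth_numbers A)"
      by (rule has_sum_cmult_left[OF IH(2)])
    show "?h summable_on smooth_numbers A \<times> UNIV"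
      using summ by (rule abs_summable_summable)
  qed
  also have "(?h has_sum (\<Prod>p\<in>A. \<Sum>k. g p k) * (\<Sum>k. g p k)) (smooth_numbers A \<times> UNIV) \<longleftrightarrow>
    ((\<lambda>x. prime_power_product g (case x of (n, k) \<Rightarrow> n * p ^ k)) has_sum
      (\<Prod>p\<in>A. \<Sum>k. g p k) * (\<Sum>k. g p k)) (smooth_numbers A \<times> UNIV)"
    by (rule has_sum_cong) (auto simp: eq)
  also have "\<dots> \<longleftrightarrow> (prime_power_product g has_sum (\<Prod>p\<in>A. \<Sum>k. g p k) * (\<Sum>k. g p k))
      (smooth_numbers (insert p A))"
    by (rule has_sum_reindex_bij_betw[OF bij_betw_smooth_numbers_insert[OF p insert.hyps(2)]])
  finally have 1: "(prime_power_product g has_sum (\<Prod>p\<in>insert p A. \<Sum>k. g p k))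
      (smooth_numbers (insert p A))"
    using insert.hyps by (simp add: mult.commute)
  have "(\<lambda>x. norm (?h x)) summable_on smooth_numbers A \<times> UNIV \<longleftrightarrow>
    (\<lambda>x. norm (prime_power_product g (case x of (n, k) \<Rightarrow> n * p ^ k)))
      summable_on smooth_numbers A \<times> UNIV"
    by (rule summable_on_cong) (auto simp: eq)
  also have "\<dots> \<longleftrightarrow> (\<lambda>n. norm (prime_power_product g n)) summable_on smooth_numbers (insert p A)"
    by (rule summable_on_reindex_bij_betw[OF bij_betw_smooth_numbers_insert[OF p insert.hyps(2)]])
  finally show ?case using summ 1 by blast
qed

text \<open>Finite Euler products of the norms bound all partial sums by
  \<open>exp (suminf u)\<close>, which gives absolute convergence. The same finite products, now
  without norms, tend to the full series by dominated convergence.\<close>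

theorem euler_product:
  fixes g :: "nat \<Rightarrow> nat \<Rightarrow> complex" and u :: "nat \<Rightarrow> real"
  assumes g0: "\<And>p. prime p \<Longrightarrow> g p 0 = 1"
    and g_summable: "\<And>p. prime p \<Longrightarrow> summable (\<lambda>k. norm (g p k))"
    and g_le: "\<And>p. prime p \<Longrightarrow> (\<Sum>k. norm (g p k)) \<le> 1 + u p"
    and u: "\<And>p. 0 \<le> u p" "summable u"
  shows "summable (\<lambda>n. norm (prime_power_product g (Suc n)))"
    and "(\<lambda>p. if prime p then \<Sum>k. g p k else 1) has_prod (\<Sum>n. prime_power_product g (Suc n))"
proof -
  define A where "A = (\<lambda>N. {p. prime p \<and> p \<le> (N::nat)})"
  have A: "finite (A N)" "\<And>p. p \<in> A N \<Longrightarrow> prime p" for N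
    unfolding A_def by auto
  have Suc_smooth: "Suc n \<in> smooth_numbers (A N)" if "n < N" for n N
  proof -
    have "p \<le> N" if "p dvd Suc n" for p
      using dvd_imp_le[OF that] \<open>n < N\<close> by simp
    then show ?thesis
      by (auto simp: smooth_numbers_def A_def in_prime_factors_iff)
  qed
  define f where "f = (\<lambda>n. prime_power_product g (Suc n))"
  have bounded: "(\<Sum>n<N. norm (f n)) \<le> exp (suminf u)" for N
  proof -
    \<comment> \<open>Every number up to \<open>N\<close> is smooth over the primes up to
      \<open>N\<close>, and all terms are nonnegative, so the partial sum is at most the finite
      product of the local sums of norms.\<close>
    let ?g = "\<lambda>p k. norm (g p k)"
    have "(prime_power_product ?g has_sum (\<Prod>p\<in>A N. \<Sum>k. ?g p k)) (smooth_numbers (A N))"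
      by (rule conjunct2[OF has_sum_smooth_numbers]) (use A g0 g_summable in auto)
    moreover have "Suc ` {..<N} \<subseteq> smooth_numbers (A N)"
      using Suc_smooth by auto
    ultimately have "sum (prime_power_product ?g) (Suc ` {..<N}) \<le> (\<Prod>p\<in>A N. \<Sum>k. ?g p k)"
      by (intro finite_sum_le_has_sum[where A = "smooth_numbers (A N)"])
        (auto simp: prime_power_product_def intro!: prod_nonneg)
    moreover have "(\<Sum>n<N. norm (f n)) = sum (prime_power_product ?g) (Suc ` {..<N})"
      by (simp add: f_def prime_power_product_def sum.reindex flip: prod_norm)
    moreover have "(\<Prod>p\<in>A N. \<Sum>k. ?g p k) \<le> (\<Prod>p\<in>A N. 1 + u p)"
      using A g_le g_summable by (intro prod_mono) (auto intro!: suminf_nonneg)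
    moreover have "(\<Prod>p\<in>A N. 1 + u p) \<le> exp (sum u (A N))"
      by (rule prod_le_exp_sum) (use u in auto)
    moreover have "sum u (A N) \<le> suminf u"
      by (rule sum_le_suminf) (use A u in auto)
    moreover from this have "exp (sum u (A N)) \<le> exp (suminf u)"
      by simp
    ultimately show ?thesis
      by linarith
  qed
  have f: "summable (\<lambda>n. norm (f n))"
    by (rule summableI_nonneg_bounded[of _ "exp (suminf u)"]) (use bounded in auto)
  then show "summable (\<lambda>n. norm (prime_power_product g (Suc n)))"
    by (simp add: f_def)
  \<comment> \<open>The series restricted to numbers smooth over the primes up to \<open>N\<close>.
    For fixed \<open>n\<close> it agrees with \<open>f n\<close> as soon as \<open>N > n\<close>,
    and it is dominated by \<open>norm (f n)\<close>.\<close>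
  define h where "h = (\<lambda>n N. if Suc n \<in> smooth_numbers (A N) then f n else 0)"
  have h_sums: "(\<lambda>n. h n N) sums (\<Prod>p\<in>A N. \<Sum>k. g p k)" for N
  proof -
    have "(prime_power_product g has_sum (\<Prod>p\<in>A N. \<Sum>k. g p k)) (smooth_numbers (A N))"
      by (rule conjunct2[OF has_sum_smooth_numbers]) (use A g0 g_summable in auto)
    also have "smooth_numbers (A N) = Suc ` {n. Suc n \<in> smooth_numbers (A N)}"
    proof safe
      fix n assume "n \<in> smooth_numbers (A N)"
      then show "n \<in> Suc ` {n. Suc n \<in> smooth_numbers (A N)}"
        by (cases n) (auto simp: smooth_numbers_def)
    qed
    also have "(prime_power_product g has_sum (\<Prod>p\<in>A N. \<Sum>k. g p k)) \<dots> \<longleftrightarrow>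
        ((prime_power_product g \<circ> Suc) has_sum (\<Prod>p\<in>A N. \<Sum>k. g p k))
          {n. Suc n \<in> smooth_numbers (A N)}"
      by (rule has_sum_reindex) auto
    also have "\<dots> \<longleftrightarrow> ((\<lambda>n. h n N) has_sum (\<Prod>p\<in>A N. \<Sum>k. g p k)) UNIV"
      by (rule has_sum_cong_neutral) (auto simp: h_def f_def)
    finally show ?thesis by (rule has_sum_imp_sums)
  qed
  have "((\<lambda>N. \<Sum>n. h n N) \<longlongrightarrow> suminf f) sequentially"
  proof (rule conjunct2[OF conjunct2[OF tannerys_theorem]])
    show "((\<lambda>N. h n N) \<longlongrightarrow> f n) sequentially" for n
      by (rule tendsto_eventually, rule eventually_mono[OF eventually_gt_at_top[of n]])
        (use Suc_smooth in \<open>auto simp: h_def\<close>)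
    show "eventually (\<lambda>(n, N). norm (h n N) \<le> norm (f n)) (at_top \<times>\<^sub>F sequentially)"
      by (intro always_eventually) (auto simp: h_def)
  qed (use f in auto)
  then have lim: "(\<lambda>N. \<Prod>p\<in>A N. \<Sum>k. g p k) \<longlonglongrightarrow> suminf f"
    using h_sums by (simp add: sums_iff)
  let ?e = "\<lambda>p. if prime p then \<Sum>k. g p k else 1"
  \<comment> \<open>A limit of partial products does not suffice for \<open>has_prod\<close>; the
    product must also converge in the strict sense. Removing the leading term 1 from each local
    series gives the required absolutely summable deviations.\<close>
  have e: "norm (?e p - 1) \<le> u p" for p
  proof (cases "prime p")
    case True
    have s: "summable (\<lambda>k. norm (g p (Suc k)))"
      using g_summable[OF True] by (subst summable_Suc_iff)
    have "(\<Sum>k. g p k) = (\<Sum>k. g p (Suc k)) + 1"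
      using suminf_split_head[OF summable_norm_cancel[OF g_summable[OF True]]] g0[OF True]
      by (simp add: algebra_simps)
    then have "norm (?e p - 1) = norm (\<Sum>k. g p (Suc k))"
      using True by simp
    also have "\<dots> \<le> (\<Sum>k. norm (g p (Suc k)))"
      by (rule summable_norm[OF s])
    also have "\<dots> = (\<Sum>k. norm (g p k)) - 1"
      using suminf_split_head[OF g_summable[OF True]] g0[OF True] by simp
    finally show ?thesis using g_le[OF True] by simp
  qed (use u in auto)
  have "summable (\<lambda>p. norm (?e p - 1))"
    by (rule summable_comparison_test'[OF u(2), of 0]) (use e in auto)
  then have "convergent_prod ?e"
    by (intro abs_convergent_prod_imp_convergent_prod summable_imp_abs_convergent_prod)
  moreover have "(\<lambda>N. \<Prod>p\<le>N. ?e p) \<longlonglongrightarrow> suminf f"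
  proof -
    have "(\<Prod>p\<le>N. ?e p) = (\<Prod>p\<in>A N. \<Sum>k. g p k)" for N
      by (rule prod.mono_neutral_cong_right) (auto simp: A_def)
    then show ?thesis using lim by simp
  qed
  ultimately show "?e has_prod (\<Sum>n. prime_power_product g (Suc n))"
    unfolding f_def by (rule convergent_prod_tendsto_imp_has_prod)
qed

subsection \<open>Entire infinite products and growth estimates\<close>

text \<open>A summable majorant on each disc makes the partial products converge locally uniformly
  by the Weierstrass test, and holomorphy passes to the limit.\<close>

lemma entire_prodinf:
  fixes f :: "nat \<Rightarrow> complex \<Rightarrow> complex"
  assumes hol: "\<And>n. f n holomorphic_on UNIV"
    and bound: "\<And>r. \<exists>M. summable M \<and> (\<forall>n s. cmod s \<le> r \<longrightarrow> norm (f n s - 1) \<le> M n)"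
  shows "(\<lambda>n. f n s) has_prod (\<Prod>n. f n s)"
    and "(\<lambda>s. \<Prod>n. f n s) holomorphic_on UNIV"
proof -
  have conv: "convergent_prod (\<lambda>n. f n s)" for s
  proof -
    obtain M where M: "summable M" "\<And>n t. cmod t \<le> cmod s \<Longrightarrow> norm (f n t - 1) \<le> M n"
      using bound[of "cmod s"] by blast
    have "summable (\<lambda>n. norm (f n s - 1))"
      by (rule summable_comparison_test'[OF M(1), of 0]) (use M(2) in auto)
    then show ?thesis
      by (intro abs_convergent_prod_imp_convergent_prod summable_imp_abs_convergent_prod)
  qed
  then show "(\<lambda>n. f n s) has_prod (\<Prod>n. f n s)"
    by (rule convergent_prod_has_prod)
  show "(\<lambda>s. \<Prod>n. f n s) holomorphic_on UNIV"
  proof (rule holomorphic_uniform_sequence)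
    show "(\<lambda>s. \<Prod>n<N. f n s) holomorphic_on UNIV" for N
      by (intro holomorphic_on_prod hol)
    fix x :: complex
    \<comment> \<open>The radius \<open>cmod x + 1\<close> is chosen so that the disc about 0
      contains \<open>cball x 1\<close>.\<close>
    obtain M where M: "summable M" "\<And>n t. cmod t \<le> cmod x + 1 \<Longrightarrow> norm (f n t - 1) \<le> M n"
      using bound[of "cmod x + 1"] by blast
    have in_ball: "cmod t \<le> cmod x + 1" if "t \<in> cball x 1" for t
      using that norm_triangle_ineq2[of t x] by (simp add: dist_norm norm_minus_commute)
    have "uniformly_convergent_on (cball x 1) (\<lambda>N s. \<Prod>n<N. f n s)"
    proof (rule uniformly_convergent_on_prod')
      show "continuous_on (cball x 1) (f n)" for n
        using holomorphic_on_imp_continuous_on[OF hol] continuous_on_subset by blast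
      show "uniformly_convergent_on (cball x 1) (\<lambda>N s. \<Sum>n<N. norm (f n s - 1))"
        by (rule Weierstrass_m_test'[OF _ M(1)]) (use M(2) in_ball in auto)
    qed simp
    then obtain l where l: "uniform_limit (cball x 1) (\<lambda>N s. \<Prod>n<N. f n s) l sequentially"
      by (auto simp: uniformly_convergent_on_def)
    have "l s = (\<Prod>n. f n s)" if "s \<in> cball x 1" for s
    proof (rule LIMSEQ_unique)
      show "(\<lambda>N. \<Prod>n<N. f n s) \<longlonglongrightarrow> l s"
        by (rule tendsto_uniform_limitI[OF l that])
      show "(\<lambda>N. \<Prod>n<N. f n s) \<longlonglongrightarrow> (\<Prod>n. f n s)"
        using convergent_prod_has_prod[OF conv] by (rule has_prod_imp_tendsto')
    qed
    then have "uniform_limit (cball x 1) (\<lambda>N s. \<Prod>n<N. f n s) (\<lambda>s. \<Prod>n. f n s) sequentially"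
      using l by (subst (asm) uniform_limit_cong'[OF refl]) auto
    then show "\<exists>d>0. cball x d \<subseteq> UNIV \<and>
        uniform_limit (cball x d) (\<lambda>N s. \<Prod>n<N. f n s) (\<lambda>s. \<Prod>n. f n s) sequentially"
      by (intro exI[of _ 1]) auto
  qed auto
qed

text \<open>Factoring \<open>t ^ d - 1\<close> with \<open>t = 1 + x n\<close> leaves a geometric
  sum, bounded uniformly in \<open>n\<close> because each \<open>x n\<close> is at most
  \<open>suminf x\<close>.\<close>

lemma summable_one_plus_power_minus_one:
  fixes x :: "nat \<Rightarrow> real"
  assumes "summable x" "\<And>n. 0 \<le> x n"
  shows "summable (\<lambda>n. (1 + x n) ^ d - 1)"
proof (rule summable_comparison_test')
  show "summable (\<lambda>n. x n * (\<Sum>i<d. (1 + suminf x) ^ i))"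
    using assms(1) by (rule summable_mult2)
  fix n :: nat
  have "x n \<le> suminf x"
    using sum_le_suminf[OF assms(1), of "{n}"] assms(2) by simp
  have "(1 + x n) ^ d - 1 = x n * (\<Sum>i<d. (1 + x n) ^ i)"
    by (subst power_diff_1_eq) auto
  moreover have "\<dots> \<le> x n * (\<Sum>i<d. (1 + suminf x) ^ i)"
    using assms(2)[of n] \<open>x n \<le> suminf x\<close> by (intro mult_left_mono sum_mono power_mono) auto
  moreover have "(1 + x n) ^ d \<ge> 1"
    using assms(2)[of n] by (intro one_le_power) auto
  ultimately show "norm ((1 + x n) ^ d - 1) \<le> x n * (\<Sum>i<d. (1 + suminf x) ^ i)"
    by simp
qed

text \<open>Exponential decay beats every power of \<open>n\<close>. This is why the twist makes the
  product over primes converge for all \<open>s\<close>.\<close>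

lemma summable_power_mult_powr:
  fixes a R :: real
  assumes "0 < a" "a < 1"
  shows "summable (\<lambda>n. a ^ n * real n powr R)"
proof -
  define l where "l = ln a"
  have l: "l < 0" "a = exp l" using assms by (auto simp: l_def)
  have big: "(\<lambda>n. exp (real n * l) * real n powr R) \<in> O(\<lambda>n. 1 / real n ^ 2)"
    using l(1) by real_asymp
  have "summable (\<lambda>n. norm (1 / real n ^ 2))"
    using inverse_power_summable[of 2, where ?'a = real] by (simp add: field_simps)
  from this big have "summable (\<lambda>n. exp (real n * l) * real n powr R)"
    by (rule summable_comparison_test_bigo)
  then show ?thesis
    by (simp add: l(2) exp_of_nat_mult)
qed

text \<open>From 3 on, passing from \<open>n\<close> to \<open>n + 1\<close> at most triples the
  cube; the values 0, 1, 2 are checked directly. Equality holds at 3.\<close>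

lemma cube_le_three_power: "n ^ 3 \<le> (3::nat) ^ n"
proof -
  have "n ^ 3 \<le> (3::nat) ^ n" if "n \<ge> 3"
    using that
  proof (induction n rule: dec_induct)
    case (step n)
    have "3 \<le> n" using step.hyps by simp
    then have "3 * (n * n) \<le> n * (n * n)" "(3 * 3) * n \<le> (n * n) * n"
      by (intro mult_le_mono order.refl; assumption)+
    moreover have "Suc n ^ 3 = n * (n * n) + 3 * (n * n) + 3 * n + 1" "n ^ 3 = n * (n * n)"
      by (simp_all add: power3_eq_cube algebra_simps)
    moreover have "(n * n) * n = n * (n * n)" by simp
    ultimately have "Suc n ^ 3 \<le> 3 * n ^ 3"
      using \<open>3 \<le> n\<close> by linarith
    then show ?case using step.IH by simp
  qed simp
  moreover have "n = 0 \<or> n = 1 \<or> n = 2 \<or> n \<ge> 3" by auto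
  ultimately show ?thesis by auto
qed

section \<open>Abscissas, complex powers of integers, and poles of reciprocals\<close>

text \<open>The set lies between an open and a closed half-plane, so nothing has to be known on the
  line \<open>Re s = \<sigma>\<close> itself.\<close>

lemma Inf_Re_eqI:
  assumes "\<And>s. s \<in> S \<Longrightarrow> \<sigma> \<le> Re s" "\<And>s. \<sigma> < Re s \<Longrightarrow> s \<in> S"
  shows "(INF s\<in>S. ereal (Re s)) = ereal \<sigma>"
proof (rule antisym)
  show "(INF s\<in>S. ereal (Re s)) \<le> ereal \<sigma>"
  proof (rule ereal_le_epsilon2)
    fix e :: real assume "e > 0"
    then show "(INF s\<in>S. ereal (Re s)) \<le> ereal \<sigma> + ereal e"
      using assms(2)[of "complex_of_real (\<sigma> + e)"]
      by (intro INF_lower2[of "complex_of_real (\<sigma> + e)"]) auto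
  qed
  show "ereal \<sigma> \<le> (INF s\<in>S. ereal (Re s))"
    using assms(1) by (intro INF_greatest) auto
qed

lemma norm_of_nat_powr: "norm (of_nat n powr s :: complex) = real n powr Re s"
  by (subst norm_powr_real_powr) auto

text \<open>Multiplied by \<open>ln n\<close>, the shift becomes exactly one period of the
  exponential function.\<close>

lemma of_nat_powr_periodic:
  assumes "n > 1"
  shows "(of_nat n :: complex) powr (s + \<i> * of_real (2 * pi / ln (real n))) = of_nat n powr s"
proof -
  have "ln (real n) \<noteq> 0" using assms by simp
  then have "(s + \<i> * of_real (2 * pi / ln (real n))) * of_real (ln (real n))
      = s * of_real (ln (real n)) + of_real (2 * pi) * \<i>"
    by (simp add: algebra_simps)
  then show ?thesis
    using assms by (simp add: powr_def exp_add flip: Ln_of_nat)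
qed

lemma of_nat_prod_power_powr:
  "(of_nat (\<Prod>x\<in>A. f x ^ k x) :: complex) powr s = (\<Prod>x\<in>A. (of_nat (f x) powr s) ^ k x)"
proof -
  have mult: "(of_nat (m * n) :: complex) powr s = of_nat m powr s * of_nat n powr s" for m n
    by (simp add: powr_times_real)
  have "(of_nat (m ^ j) :: complex) powr s = (of_nat m powr s) ^ j" for m j
    by (induction j) (simp_all add: mult del: of_nat_mult of_nat_power)
  then show ?thesis
    by (induction A rule: infinite_finite_induct)
      (simp_all add: mult del: of_nat_mult of_nat_power of_nat_prod)
qed

text \<open>The point \<open>z0\<close> rules out the zero function; the zeros of \<open>G\<close>
  are then isolated, and this is what turns them into poles of the inverse.\<close>

lemma is_pole_inverse_entire_iff:
  assumes "G holomorphic_on UNIV" "G z0 \<noteq> 0"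
  shows "is_pole (\<lambda>s. inverse (G s)) s \<longleftrightarrow> G s = 0"
proof -
  have "isCont G s"
    using holomorphic_on_imp_continuous_on[OF assms(1)] by (simp add: continuous_on_eq_continuous_at)
  then have lim: "G \<midarrow>s\<rightarrow> G s" by (simp add: isCont_def)
  have "eventually (\<lambda>z. G z \<noteq> 0) (at s)" if zero: "G s = 0"
  proof -
    obtain r where "0 < r" "\<And>z. z \<in> ball s r - {s} \<Longrightarrow> G z \<noteq> 0"
      using isolated_zeros[OF assms(1) open_UNIV connected_UNIV _ zero _ assms(2)] by auto
    then show ?thesis
      by (auto simp: eventually_at dist_commute intro!: exI[of _ r])
  qed
  moreover have "G s = 0" if "G \<midarrow>s\<rightarrow> 0"
    using LIM_unique[OF lim that] .
  ultimately show ?thesis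
    using lim by (auto simp: is_pole_inverse_iff isolated_zero_def)
qed

subsection \<open>The twisted Euler product\<close>

text \<open>Good and bad primes are treated alike here through an upper bound on the inverse roots;
  \<open>W\<close> stands for half the weight.\<close>

locale twisted_euler_product =
  fixes d :: nat and W :: real and P :: "nat \<Rightarrow> complex poly" and \<alpha> :: complex
  assumes inverse_roots: "\<And>p. prime p \<Longrightarrow>
      \<exists>c. P p = (\<Prod>i<d. [:1, - c i:]) \<and> (\<forall>i<d. cmod (c i) \<le> real p powr W)"
    and alpha: "0 < cmod \<alpha>" "cmod \<alpha> < 1"
begin

definition local_arg :: "nat \<Rightarrow> complex \<Rightarrow> complex" where
  "local_arg p s = \<alpha> ^ p * of_nat p powr (- s)"

definition local_term :: "complex \<Rightarrow> nat \<Rightarrow> nat \<Rightarrow> complex" where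
  "local_term s p k = fps_nth (inverse (fps_of_poly (P p))) k * local_arg p s ^ k"

definition abscissa :: real where
  "abscissa = 3 / ln 3 * ln (cmod \<alpha>) + W"

lemma norm_local_arg: "cmod (local_arg p s) = cmod \<alpha> ^ p * real p powr (- Re s)"
  by (simp add: local_arg_def norm_mult norm_power norm_of_nat_powr)

text \<open>On taking logarithms, \<open>cube_le_three_power\<close> replaces \<open>p\<close> by
  \<open>3 / ln 3 * ln p\<close>, with the inequality reversed by the negative factor
  \<open>ln (cmod \<alpha>)\<close>. What remains is \<open>(abscissa - Re s) * ln p\<close>,
  largest at the smallest prime 2. The bound is below 1 and independent of \<open>p\<close>.\<close>

lemma local_bound_le:
  assumes "prime p" "abscissa < Re s"
  shows "cmod \<alpha> ^ p * real p powr (W - Re s) \<le> 2 powr (abscissa - Re s)"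
proof -
  have p: "p \<ge> 2" using assms prime_ge_2_nat by blast
  have l: "ln (cmod \<alpha>) < 0" using alpha by simp
  have "ln (real p ^ 3) \<le> ln (3 ^ p)"
    using p of_nat_mono[OF cube_le_three_power[of p], where ?'a = real]
    by (subst ln_le_cancel_iff) auto
  then have "3 / ln 3 * ln (real p) \<le> real p"
    using p by (simp add: ln_realpow field_simps)
  then have "real p * ln (cmod \<alpha>) \<le> 3 / ln 3 * ln (real p) * ln (cmod \<alpha>)"
    using l by (intro mult_right_mono_neg) auto
  moreover have "(abscissa - Re s) * ln (real p) \<le> (abscissa - Re s) * ln 2"
    using assms p by (intro mult_left_mono_neg) auto
  ultimately have "real p * ln (cmod \<alpha>) + (W - Re s) * ln (real p) \<le> (abscissa - Re s) * ln 2"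
    by (simp add: abscissa_def algebra_simps)
  moreover have "cmod \<alpha> ^ p * real p powr (W - Re s)
      = exp (real p * ln (cmod \<alpha>) + (W - Re s) * ln (real p))"
    using p alpha by (simp add: powr_def exp_add exp_of_nat_mult)
  ultimately show ?thesis
    by (simp add: powr_def)
qed

lemma twisted_local_factor_eq_0_iff:
  assumes "P p = (\<Prod>i<d. [:1, - c i:])"
  shows "twisted_local_factor P \<alpha> p s = 0 \<longleftrightarrow> (\<exists>i<d. c i * local_arg p s = 1)"
  unfolding twisted_local_factor_def local_arg_def[symmetric] assms
  by (auto simp: poly_prod mult.commute)

text \<open>Each inverse root times \<open>local_arg p s\<close> has norm at most
  \<open>x < 1\<close>, so the geometric expansions apply and no linear factor vanishes.\<close>

lemma local_factor_props:
  assumes "prime p" "abscissa < Re s"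
  defines "x \<equiv> cmod \<alpha> ^ p * real p powr (W - Re s)"
  shows "summable (\<lambda>k. norm (local_term s p k))"
    and "(\<Sum>k. norm (local_term s p k)) \<le> (1 / (1 - x)) ^ d"
    and "local_term s p sums inverse (twisted_local_factor P \<alpha> p s)"
    and "twisted_local_factor P \<alpha> p s \<noteq> 0"
proof -
  obtain c where c: "P p = (\<Prod>i<d. [:1, - c i:])" "\<And>i. i < d \<Longrightarrow> cmod (c i) \<le> real p powr W"
    using inverse_roots[OF assms(1)] by blast
  have "2 powr (abscissa - Re s) < 2 powr 0"
    using assms(2) by (intro powr_less_mono) auto
  then have x: "0 \<le> x" "x < 1"
    using local_bound_le[OF assms(1,2)] by (auto simp: x_def)
  have cx: "cmod (c i) * cmod (local_arg p s) \<le> x" if "i < d" for i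
  proof -
    have "cmod (c i) * cmod (local_arg p s) \<le> real p powr W * cmod (local_arg p s)"
      by (rule mult_right_mono) (use c that in auto)
    also have "\<dots> = x"
      by (simp add: x_def norm_local_arg powr_diff powr_minus field_simps)
    finally show ?thesis .
  qed
  have "summable (\<lambda>k. norm (local_term s p k)) \<and>
      (\<Sum>k. norm (local_term s p k)) \<le> (1 / (1 - x)) ^ d \<and>
      local_term s p sums inverse (twisted_local_factor P \<alpha> p s)"
    using inverse_fps_of_linear_prod_sums[of d c "local_arg p s" x] cx x
    unfolding local_term_def c(1)[symmetric] twisted_local_factor_def local_arg_def[symmetric]
    by auto
  then show "summable (\<lambda>k. norm (local_term s p k))"
    and "(\<Sum>k. norm (local_term s p k)) \<le> (1 / (1 - x)) ^ d"
    and "local_term s p sums inverse (twisted_local_factor P \<alpha> p s)"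
    by auto
  have "c i * local_arg p s \<noteq> 1" if "i < d" for i
    using cx[OF that] x(2) by (metis norm_mult norm_one not_le)
  then show "twisted_local_factor P \<alpha> p s \<noteq> 0"
    using twisted_local_factor_eq_0_iff[OF c(1)] by blast
qed

lemma local_term_0:
  assumes "prime p"
  shows "local_term s p 0 = 1"
proof -
  obtain c where "P p = (\<Prod>i<d. [:1, - c i:])"
    using inverse_roots[OF assms] by blast
  then have "coeff (P p) 0 = 1"
    by (simp add: poly_prod flip: poly_0_coeff_0)
  then show ?thesis
    by (simp add: local_term_def)
qed

text \<open>Both \<open>\<alpha> ^ sum_prime_factors n\<close> and the complex power of
  \<open>n\<close> are completely multiplicative, so they distribute over the prime powers in
  \<open>n\<close> and turn each local coefficient into a \<open>local_term\<close>.\<close>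

lemma dirichlet_term_eq:
  "dirichlet_term (twisted_coeff P \<alpha>) s n = prime_power_product (local_term s) (Suc n)"
proof -
  define m where "m = Suc n"
  have "(of_nat m :: complex) powr (- s)
      = of_nat (\<Prod>p\<in>prime_factors m. p ^ multiplicity p m) powr (- s)"
    using prod_prime_factors[of m] by (simp add: m_def)
  then show ?thesis
    unfolding dirichlet_term_def m_def[symmetric] of_nat_prod_power_powr
    by (simp add: twisted_coeff_def sum_prime_factors_def euler_coeff_def prime_power_product_def
        local_term_def local_arg_def power_sum power_mult_distrib power_mult[symmetric]
        mult.commute[of _ "multiplicity _ _"] flip: prod.distrib)
       (simp add: mult_ac)
qed

lemma dirichlet_series_euler_product:
  assumes s: "abscissa < Re s"
  shows "summable (\<lambda>n. norm (dirichlet_term (twisted_coeff P \<alpha>) s n))"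
    and "(\<lambda>p. if prime p then inverse (twisted_local_factor P \<alpha> p s) else 1)
      has_prod suminf (dirichlet_term (twisted_coeff P \<alpha>) s)"
proof -
  define q where "q = 2 powr (abscissa - Re s)"
  have "2 powr (abscissa - Re s) < 2 powr 0"
    using s by (intro powr_less_mono) auto
  then have q: "q < 1" by (simp add: q_def)
  define x where "x = (\<lambda>p. cmod \<alpha> ^ p * real p powr (W - Re s))"
  have x0: "0 \<le> x p" for p by (simp add: x_def)
  have xq: "x p \<le> q" if "prime p" for p
    using local_bound_le[OF that s] by (simp add: x_def q_def)
  \<comment> \<open>For \<open>0 \<le> x \<le> q < 1\<close> one has
    \<open>1 / (1 - x) \<le> 1 + x / (1 - q)\<close>. The common denominator \<open>1 - q\<close>
    lets summability of \<open>x\<close> carry over to \<open>u\<close>.\<close>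
  define u where "u = (\<lambda>p. (1 + x p / (1 - q)) ^ d - 1)"
  have u: "summable u" "0 \<le> u p" for p
  proof -
    show "summable u"
      unfolding u_def x_def using summable_power_mult_powr[OF alpha] q
      by (intro summable_one_plus_power_minus_one summable_divide) auto
    have "(1 + x p / (1 - q)) ^ d \<ge> 1"
      using x0[of p] q by (intro one_le_power) auto
    then show "0 \<le> u p" by (simp add: u_def)
  qed
  have le: "(\<Sum>k. norm (local_term s p k)) \<le> 1 + u p" if "prime p" for p
  proof -
    have "1 / (1 - x p) = 1 + x p / (1 - x p)"
      using xq[OF that] q by (simp add: field_simps)
    also have "\<dots> \<le> 1 + x p / (1 - q)"
      using xq[OF that] q x0[of p] by (intro add_left_mono divide_left_mono) auto
    finally have "(1 / (1 - x p)) ^ d \<le> (1 + x p / (1 - q)) ^ d"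
      using xq[OF that] q by (intro power_mono) auto
    then show ?thesis
      using local_factor_props(2)[OF that s] by (simp add: u_def x_def)
  qed
  note ep = euler_product[of "local_term s" u, OF local_term_0 local_factor_props(1)[OF _ s] le u(2,1)]
  show "summable (\<lambda>n. norm (dirichlet_term (twisted_coeff P \<alpha>) s n))"
    using ep(1) by (simp add: dirichlet_term_eq)
  have "(if prime p then \<Sum>k. local_term s p k else 1)
      = (if prime p then inverse (twisted_local_factor P \<alpha> p s) else 1)" for p
    using local_factor_props(3)[OF _ s, of p] by (auto simp: sums_iff)
  then show "(\<lambda>p. if prime p then inverse (twisted_local_factor P \<alpha> p s) else 1)
      has_prod suminf (dirichlet_term (twisted_coeff P \<alpha>) s)"
    using ep(2) by (simp add: dirichlet_term_eq[abs_def])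
qed

section \<open>The entire reciprocal of the twisted L-function and its zeros\<close>

definition reciprocal_L :: "complex \<Rightarrow> complex" where
  "reciprocal_L s = (\<Prod>p. if prime p then twisted_local_factor P \<alpha> p s else 1)"

lemma reciprocal_L_props:
  shows "(\<lambda>p. if prime p then twisted_local_factor P \<alpha> p s else 1) has_prod reciprocal_L s"
    and "reciprocal_L holomorphic_on UNIV"
proof -
  define f where "f = (\<lambda>p s. if prime p then twisted_local_factor P \<alpha> p s else 1)"
  have hol: "f p holomorphic_on UNIV" for p
  proof (cases "prime p")
    case True
    then have "f p = (\<lambda>s. poly (P p) (\<alpha> ^ p * of_nat p powr (- s)))" "p > 0"
      by (auto simp: f_def twisted_local_factor_def prime_gt_0_nat)
    then show ?thesis
      by (auto intro!: holomorphic_intros)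
  qed (simp add: f_def)
  have bound: "\<exists>M. summable M \<and> (\<forall>p s. cmod s \<le> r \<longrightarrow> norm (f p s - 1) \<le> M p)" for r
  proof (intro exI conjI allI impI)
    \<comment> \<open>The exponent \<open>W + r\<close> serves the whole disc at once, because
      \<open>- Re s \<le> r\<close> there.\<close>
    define x where "x = (\<lambda>p. cmod \<alpha> ^ p * real p powr (W + r))"
    show "summable (\<lambda>p. (1 + x p) ^ d - 1)"
      unfolding x_def using summable_power_mult_powr[OF alpha]
      by (intro summable_one_plus_power_minus_one) auto
    fix p :: nat and s :: complex assume s: "cmod s \<le> r"
    have x0: "0 \<le> x p" by (simp add: x_def)
    show "norm (f p s - 1) \<le> (1 + x p) ^ d - 1"
    proof (cases "prime p")
      case True
      then have p: "p \<ge> 2" using prime_ge_2_nat by blast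
      obtain c where c: "P p = (\<Prod>i<d. [:1, - c i:])" "\<And>i. i < d \<Longrightarrow> cmod (c i) \<le> real p powr W"
        using inverse_roots[OF True] by blast
      have "- Re s \<le> r" using s abs_Re_le_cmod[of s] by linarith
      then have "real p powr (- Re s) \<le> real p powr r"
        using p by (intro powr_mono) auto
      then have arg: "cmod (local_arg p s) \<le> cmod \<alpha> ^ p * real p powr r"
        unfolding norm_local_arg by (intro mult_left_mono) auto
      have ci: "norm (- c i * local_arg p s) \<le> x p" if "i < d" for i
      proof -
        have "norm (- c i * local_arg p s) \<le> real p powr W * (cmod \<alpha> ^ p * real p powr r)"
          using c(2)[OF that] arg by (simp add: norm_mult mult_mono)
        then show ?thesis by (simp add: x_def powr_add mult_ac)
      qed
      have "f p s = (\<Prod>i<d. 1 + (- c i * local_arg p s))"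
        using True unfolding f_def twisted_local_factor_def local_arg_def[symmetric] c(1)
        by (simp add: poly_prod mult.commute)
      then have "norm (f p s - 1) \<le> (\<Prod>i<d. 1 + norm (- c i * local_arg p s)) - 1"
        using norm_prod_minus1_le_prod_minus1[of "\<lambda>i. - c i * local_arg p s" "{..<d}"] by simp
      also have "(\<Prod>i<d. 1 + norm (- c i * local_arg p s)) \<le> (\<Prod>i<d. 1 + x p)"
        using ci by (intro prod_mono) auto
      finally show ?thesis by simp
    qed (use x0 in \<open>simp add: f_def\<close>)
  qed
  show "(\<lambda>p. if prime p then twisted_local_factor P \<alpha> p s else 1) has_prod reciprocal_L s"
    using entire_prodinf(1)[of f, OF hol bound] by (simp add: f_def reciprocal_L_def)
  show "reciprocal_L holomorphic_on UNIV"
    using entire_prodinf(2)[of f, OF hol bound] by (simp add: f_def reciprocal_L_def[abs_def])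
qed

text \<open>A product that converges in the sense of \<open>has_prod\<close> is 0 only if one of its
  factors is, so the infinite product creates no further zeros.\<close>

lemma reciprocal_L_eq_0_iff:
  "reciprocal_L s = 0 \<longleftrightarrow> (\<exists>p. prime p \<and> twisted_local_factor P \<alpha> p s = 0)"
proof -
  have "reciprocal_L s = 0 \<longleftrightarrow>
      0 \<in> range (\<lambda>p. if prime p then twisted_local_factor P \<alpha> p s else 1)"
    by (rule has_prod_eq_0_iff[OF reciprocal_L_props(1)])
  also have "\<dots> \<longleftrightarrow> (\<exists>p. prime p \<and> twisted_local_factor P \<alpha> p s = 0)"
    by (auto simp: image_iff split: if_splits)
  finally show ?thesis .
qed

lemma is_pole_inverse_reciprocal_L_iff:
  "is_pole (\<lambda>s. inverse (reciprocal_L s)) s \<longleftrightarrow> reciprocal_L s = 0"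
proof (rule is_pole_inverse_entire_iff[OF reciprocal_L_props(2)])
  \<comment> \<open>Any point to the right of the abscissa would do, since no local factor vanishes
    there.\<close>
  show "reciprocal_L (of_real (abscissa + 1)) \<noteq> 0"
    using local_factor_props(4) by (auto simp: reciprocal_L_eq_0_iff)
qed

section \<open>Necessary conditions for convergence, and the zeros of the local factors\<close>

text \<open>
  A convergent series has bounded terms, in particular at the powers of \<open>p\<close>, so the power series of
  \<open>1 / P p\<close> converges inside the disc of radius \<open>|local_arg p s|\<close> and \<open>P p\<close> cannot vanish there.
\<close>

lemma summable_imp_inverse_root_le:
  assumes summ: "summable (dirichlet_term (twisted_coeff P \<alpha>) s)"
    and "prime p" "poly (P p) z = 0"
  shows "cmod (local_arg p s) \<le> cmod z"
proof (rule ccontr)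
  assume "\<not> cmod (local_arg p s) \<le> cmod z"
  then have zT: "cmod z < cmod (local_arg p s)" by simp
  define a where "a = fps_nth (inverse (fps_of_poly (P p)))"
  obtain C where C: "\<And>n. norm (dirichlet_term (twisted_coeff P \<alpha>) s n) \<le> C"
    using Bseq_eq_bounded summable_imp_Bseq[OF summ] by (auto simp: Bseq_def)
  have a_le: "norm (a k * local_arg p s ^ k) \<le> max C 1" for k
  proof (cases "k = 0")
    case True
    then show ?thesis using local_term_0[OF assms(2), of s] by (simp add: local_term_def a_def)
  next
    case False
    obtain n where n: "p ^ k = Suc n"
      using assms(2) by (metis gr0_implies_Suc prime_gt_0_nat zero_less_power)
    have "prime_power_product (local_term s) (p ^ k) = local_term s p k"
      using prime_power_product_mult_power[of "{}" "local_term s" p 1 k] assms(2) local_term_0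
      by (simp add: smooth_numbers_empty prime_power_product_def)
    then show ?thesis
      using C[of n] by (simp add: dirichlet_term_eq n a_def local_term_def)
  qed
  \<comment> \<open>An intermediate radius leaves room for a geometric majorant of ratio
    \<open>r / cmod (local_arg p s)\<close>, so that \<open>z\<close> lies strictly inside the disc
    of convergence.\<close>
  obtain r where r: "cmod z < r" "r < cmod (local_arg p s)"
    using dense[OF zT] by blast
  have r0: "0 < r" using r norm_ge_zero[of z] by linarith
  have "summable (\<lambda>k. a k * of_real r ^ k)"
  proof (rule summable_comparison_test')
    show "summable (\<lambda>k. max C 1 * (r / cmod (local_arg p s)) ^ k)"
      using r r0 by (intro summable_mult summable_geometric) (simp add: divide_less_eq)
    fix k :: nat
    have "norm (a k * of_real r ^ k)
        = norm (a k * local_arg p s ^ k) * (r / cmod (local_arg p s)) ^ k"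
      using r r0 by (auto simp: norm_mult norm_power power_divide)
    also have "\<dots> \<le> max C 1 * (r / cmod (local_arg p s)) ^ k"
      using a_le r0 by (intro mult_right_mono) auto
    finally show "norm (a k * of_real r ^ k) \<le> max C 1 * (r / cmod (local_arg p s)) ^ k" .
  qed
  then have "ereal (norm (of_real r :: complex)) \<le> fps_conv_radius (inverse (fps_of_poly (P p)))"
    unfolding fps_conv_radius_def a_def by (rule conv_radius_geI)
  moreover have "ereal (cmod z) < ereal (norm (of_real r :: complex))"
    using r r0 by simp
  ultimately have "ereal (cmod z) < fps_conv_radius (inverse (fps_of_poly (P p)))"
    by (rule less_le_trans[rotated])
  \<comment> \<open>Evaluation is multiplicative inside the disc of convergence. At the root
    \<open>z\<close> the right-hand side is 0, while the series on the left is the constant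
    1.\<close>
  then have "eval_fps (inverse (fps_of_poly (P p)) * fps_of_poly (P p)) z
      = eval_fps (inverse (fps_of_poly (P p))) z * eval_fps (fps_of_poly (P p)) z"
    by (intro eval_fps_mult) auto
  moreover have "inverse (fps_of_poly (P p)) * fps_of_poly (P p) = 1"
  proof (rule inverse_mult_eq_1)
    show "fps_nth (fps_of_poly (P p)) 0 \<noteq> 0"
      using local_term_0[OF assms(2), of s] by (auto simp: local_term_def)
  qed
  ultimately show False using assms(3) by simp
qed

text \<open>At a zero some \<open>c i * local_arg p s\<close> equals 1. Purity prescribes its
  modulus exactly as a function of \<open>Re s\<close>, which confines all zeros to one vertical
  line.\<close>

lemma pure_local_zeros:
  assumes "prime p" "d > 0"
    and c: "P p = (\<Prod>i<d. [:1, - c i:])" "\<And>i. i < d \<Longrightarrow> cmod (c i) = real p powr W"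
  defines "Z \<equiv> {s. twisted_local_factor P \<alpha> p s = 0}"
  shows "Z \<noteq> {}"
    and "s \<in> Z \<Longrightarrow> Re s = real p / ln (real p) * ln (cmod \<alpha>) + W"
    and "y \<in> Im ` Z \<longleftrightarrow> y + 2 * pi / ln (real p) \<in> Im ` Z"
proof -
  have p: "p > 1" using assms(1) prime_gt_1_nat by blast
  have lnp: "ln (real p) > 0" using p by simp
  have Z: "s \<in> Z \<longleftrightarrow> (\<exists>i<d. c i * local_arg p s = 1)" for s
    by (simp add: Z_def twisted_local_factor_eq_0_iff[OF c(1)])
  have "c 0 \<noteq> 0" using c(2)[of 0] assms(2) p by auto
  then have nz: "c 0 * \<alpha> ^ p \<noteq> 0" using alpha by auto
  \<comment> \<open>The witness solves \<open>p powr s = c 0 * \<alpha> ^ p\<close> by means of the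
    principal logarithm.\<close>
  have "of_nat p powr (- (Ln (c 0 * \<alpha> ^ p) / of_real (ln (real p)))) = inverse (c 0 * \<alpha> ^ p)"
    using p lnp nz by (simp add: powr_def exp_minus flip: Ln_of_nat)
  then have "c 0 * local_arg p (Ln (c 0 * \<alpha> ^ p) / of_real (ln (real p))) = 1"
    using nz by (simp add: local_arg_def field_simps)
  then have "Ln (c 0 * \<alpha> ^ p) / of_real (ln (real p)) \<in> Z"
    unfolding Z using assms(2) by (intro exI[of _ 0] conjI)
  then show "Z \<noteq> {}" by auto
  show "Re s = real p / ln (real p) * ln (cmod \<alpha>) + W" if s: "s \<in> Z"
  proof -
    obtain i where "i < d" "c i * local_arg p s = 1"
      using s unfolding Z by blast
    then have "real p powr W * (cmod \<alpha> ^ p * real p powr (- Re s)) = 1"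
      using c(2) by (metis norm_local_arg norm_mult norm_one)
    then have "ln (real p powr W * (cmod \<alpha> ^ p * real p powr (- Re s))) = 0"
      by simp
    then have "W * ln (real p) + real p * ln (cmod \<alpha>) - Re s * ln (real p) = 0"
      using p alpha by (simp add: ln_mult ln_realpow)
    then show ?thesis using lnp by (simp add: field_simps)
  qed
  define T where "T = 2 * pi / ln (real p)"
  \<comment> \<open>The exponent in \<open>local_arg\<close> is \<open>- s\<close>, so adding a
    period to the exponent subtracts it from \<open>s\<close>.\<close>
  have "local_arg p (s - \<i> * of_real T) = local_arg p s" for s
    using of_nat_powr_periodic[OF p, of "- s"] by (simp add: local_arg_def T_def algebra_simps)
  then have shift: "s - \<i> * of_real T \<in> Z \<longleftrightarrow> s \<in> Z" for s
    by (simp add: Z)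
  have "y + T \<in> Im ` Z" if "s \<in> Z" "y = Im s" for s
  proof (rule image_eqI)
    show "s + \<i> * of_real T \<in> Z" using shift[of "s + \<i> * of_real T"] that by simp
  qed (use that in simp)
  moreover have "y \<in> Im ` Z" if "s \<in> Z" "y + T = Im s" for s
  proof (rule image_eqI)
    show "s - \<i> * of_real T \<in> Z" using shift[of s] that by simp
  qed (use that in simp)
  ultimately show "y \<in> Im ` Z \<longleftrightarrow> y + 2 * pi / ln (real p) \<in> Im ` Z"
    unfolding T_def[symmetric] by blast
qed

text \<open>This is the bound \<open>cmod (local_arg 3 s) \<le> cmod z\<close> in logarithmic form.
  A root of modulus exactly \<open>3 powr (- W)\<close> is what makes it match the abscissa of
  absolute convergence.\<close>

lemma abscissa_le_if_summable:
  assumes "summable (dirichlet_term (twisted_coeff P \<alpha>) s)" "poly (P 3) z = 0"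
    and z: "cmod z = 3 powr (- W)"
  shows "abscissa \<le> Re s"
proof -
  have "cmod \<alpha> ^ 3 * 3 powr (- Re s) \<le> 3 powr (- W)"
    using summable_imp_inverse_root_le[OF assms(1) _ assms(2)] z by (simp add: norm_local_arg)
  then have "ln (cmod \<alpha> ^ 3 * 3 powr (- Re s)) \<le> ln (3 powr (- W))"
    using alpha by (subst ln_le_cancel_iff) auto
  then have "3 * ln (cmod \<alpha>) - Re s * ln 3 \<le> - W * ln 3"
    using alpha by (simp add: ln_mult ln_realpow)
  then show ?thesis by (simp add: abscissa_def field_simps)
qed

end

section \<open>Abscissas, meromorphic continuation and poles\<close>

text \<open>A nicely meromorphic function takes the value 0 at its poles by convention, so the
  absence of zeros is asserted away from the poles. Degree 0 is excluded because every
  \<open>P p\<close> would then be 1 and the series, reduced to its first term, would converge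
  everywhere.\<close>

theorem theorem3p5:
  fixes d :: nat and w :: int and B :: "nat set" and P :: "nat \<Rightarrow> complex poly"
    and \<alpha> :: complex
  assumes motive: "pure_motive_L_data d w B P"
    and degree_pos: "d > 0"
    and bad: "\<And>p z. p \<in> B \<Longrightarrow> poly (P p) z = 0 \<Longrightarrow>
      cmod (inverse z) \<le> real p powr (real_of_int w / 2)"
    and good_3: "3 \<notin> B"
    and alpha: "0 < cmod \<alpha>" "cmod \<alpha> < 1"
  shows "conv_abscissa (twisted_coeff P \<alpha>)
           = ereal (3 / ln 3 * ln (cmod \<alpha>) + real_of_int w / 2) \<and>
    abs_conv_abscissa (twisted_coeff P \<alpha>)
           = ereal (3 / ln 3 * ln (cmod \<alpha>) + real_of_int w / 2) \<and>
    (\<exists>F. F nicely_meromorphic_on UNIV \<and>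
      (\<forall>s. Re s > 3 / ln 3 * ln (cmod \<alpha>) + real_of_int w / 2 \<longrightarrow>
        dirichlet_term (twisted_coeff P \<alpha>) s sums F s \<and>
        (\<lambda>p. if prime p then inverse (twisted_local_factor P \<alpha> p s) else 1) has_prod F s) \<and>
      (\<forall>s. \<not> is_pole F s \<longrightarrow> F s \<noteq> 0) \<and>
      {s. is_pole F s} = (\<Union>p\<in>{p. prime p}. {s. twisted_local_factor P \<alpha> p s = 0}) \<and>
      (\<forall>p. prime p \<and> p \<notin> B \<longrightarrow>
        (let Z = {s. twisted_local_factor P \<alpha> p s = 0} in
          Z \<noteq> {} \<and> Z \<subseteq> {s. is_pole F s} \<and>
          (\<forall>s\<in>Z. Re s = real p / ln (real p) * ln (cmod \<alpha>) + real_of_int w / 2) \<and>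
          (\<forall>y. y \<in> Im ` Z \<longleftrightarrow> y + 2 * pi / ln (real p) \<in> Im ` Z))))"
proof -
  interpret pure_motive_L_data d w B P by fact
  interpret twisted_euler_product d "real_of_int w / 2" P \<alpha>
  proof
    show "\<exists>c. P p = (\<Prod>i<d. [:1, - c i:]) \<and> (\<forall>i<d. cmod (c i) \<le> real p powr (real_of_int w / 2))"
      if "prime p" for p
    proof (cases "p \<in> B")
      case True
      then show ?thesis
        using that bad local_poly_0 degree_local_poly by (intro poly_eq_prod_inverse_roots) auto
    next
      case False
      then show ?thesis
        using good_reduction[OF that] by (metis order.refl)
    qed
  qed (fact alpha)+
  have abscissa: "3 / ln 3 * ln (cmod \<alpha>) + real_of_int w / 2 = abscissa"
    by (simp add: abscissa_def)
  \<comment> \<open>Good reduction at 3 enters here: by purity, the inverse of a Frobenius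
    eigenvalue is a root of exactly the required modulus.\<close>
  obtain z where z: "poly (P 3) z = 0" "cmod z = 3 powr (- (real_of_int w / 2))"
  proof -
    obtain c :: "nat \<Rightarrow> complex" where c: "P 3 = (\<Prod>i<d. [:1, - c i:])"
      "\<And>i. i < d \<Longrightarrow> cmod (c i) = 3 powr (real_of_int w / 2)"
      using good_reduction[of 3] good_3 by auto
    have "c 0 \<noteq> 0" using c(2)[of 0] degree_pos by auto
    then have "poly (P 3) (inverse (c 0)) = 0"
      using degree_pos by (auto simp: c(1) poly_prod intro!: bexI[of _ 0])
    then show ?thesis
      using that c(2)[of 0] degree_pos by (simp add: norm_inverse powr_minus)
  qed
  have right: "dirichlet_term (twisted_coeff P \<alpha>) s sums inverse (reciprocal_L s)"
    "(\<lambda>p. if prime p then inverse (twisted_local_factor P \<alpha> p s) else 1)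
       has_prod inverse (reciprocal_L s)"
    if s: "abscissa < Re s" for s
  proof -
    have "(\<lambda>p. inverse (if prime p then twisted_local_factor P \<alpha> p s else 1))
        has_prod inverse (reciprocal_L s)"
      by (rule has_prod_inverse[OF reciprocal_L_props(1)])
    also have "(\<lambda>p. inverse (if prime p then twisted_local_factor P \<alpha> p s else 1))
        = (\<lambda>p. if prime p then inverse (twisted_local_factor P \<alpha> p s) else 1)"
      by auto
    finally show prod: "(\<lambda>p. if prime p then inverse (twisted_local_factor P \<alpha> p s) else 1)
       has_prod inverse (reciprocal_L s)" .
    \<comment> \<open>The Dirichlet series and the inverse of \<open>reciprocal_L\<close> are both
      values of the same infinite product, so they coincide.\<close>
    have "suminf (dirichlet_term (twisted_coeff P \<alpha>) s) = inverse (reciprocal_L s)"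
      by (rule has_prod_unique2[OF dirichlet_series_euler_product(2)[OF s] prod])
    then show "dirichlet_term (twisted_coeff P \<alpha>) s sums inverse (reciprocal_L s)"
      using summable_sums[OF summable_norm_cancel[OF dirichlet_series_euler_product(1)[OF s]]] by simp
  qed
  have conv: "conv_abscissa (twisted_coeff P \<alpha>) = ereal abscissa"
    unfolding conv_abscissa_def
    by (rule Inf_Re_eqI) (use abscissa_le_if_summable[OF _ z] right in \<open>auto simp: sums_iff\<close>)
  have abs_conv: "abs_conv_abscissa (twisted_coeff P \<alpha>) = ereal abscissa"
    unfolding abs_conv_abscissa_def
    by (rule Inf_Re_eqI)
      (use abscissa_le_if_summable[OF summable_norm_cancel z] dirichlet_series_euler_product(1) in auto)
  define F where "F = (\<lambda>s. inverse (reciprocal_L s))"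
  have pole: "is_pole F s \<longleftrightarrow> reciprocal_L s = 0" for s
    unfolding F_def by (rule is_pole_inverse_reciprocal_L_iff)
  have mero: "F nicely_meromorphic_on UNIV"
    unfolding F_def using reciprocal_L_props(2)
    by (intro nicely_meromorphic_on_inverse analytic_on_imp_nicely_meromorphic_on)
      (simp add: analytic_on_open)
  have good: "let Z = {s. twisted_local_factor P \<alpha> p s = 0} in
          Z \<noteq> {} \<and> Z \<subseteq> {s. is_pole F s} \<and>
          (\<forall>s\<in>Z. Re s = real p / ln (real p) * ln (cmod \<alpha>) + real_of_int w / 2) \<and>
          (\<forall>y. y \<in> Im ` Z \<longleftrightarrow> y + 2 * pi / ln (real p) \<in> Im ` Z)"
    if p: "prime p" "p \<notin> B" for p
  proof -
    obtain c :: "nat \<Rightarrow> complex" where c: "P p = (\<Prod>i<d. [:1, - c i:])"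
      "\<And>i. i < d \<Longrightarrow> cmod (c i) = real p powr (real_of_int w / 2)"
      using good_reduction[OF p] by auto
    have "{s. twisted_local_factor P \<alpha> p s = 0} \<subseteq> {s. is_pole F s}"
      using p by (auto simp: pole reciprocal_L_eq_0_iff)
    then show ?thesis
      unfolding Let_def using pure_local_zeros[OF p(1) degree_pos c] by blast
  qed
  show ?thesis
    unfolding abscissa
  proof (intro conjI exI[of _ F])
    show "{s. is_pole F s} = (\<Union>p\<in>{p. prime p}. {s. twisted_local_factor P \<alpha> p s = 0})"
      by (auto simp: pole reciprocal_L_eq_0_iff)
    show "\<forall>s. \<not> is_pole F s \<longrightarrow> F s \<noteq> 0"
      unfolding pole by (simp add: F_def)
    show "\<forall>s. abscissa < Re s \<longrightarrow> dirichlet_term (twisted_coeff P \<alpha>) s sums F s \<and>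
        (\<lambda>p. if prime p then inverse (twisted_local_factor P \<alpha> p s) else 1) has_prod F s"
      using right by (simp add: F_def)
    show "\<forall>p. prime p \<and> p \<notin> B \<longrightarrow>
        (let Z = {s. twisted_local_factor P \<alpha> p s = 0} in
          Z \<noteq> {} \<and> Z \<subseteq> {s. is_pole F s} \<and>
          (\<forall>s\<in>Z. Re s = real p / ln (real p) * ln (cmod \<alpha>) + real_of_int w / 2) \<and>
          (\<forall>y. y \<in> Im ` Z \<longleftrightarrow> y + 2 * pi / ln (real p) \<in> Im ` Z))"
      using good by blast
  qed (fact conv abs_conv mero)+
qed

end
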